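(* Let $L$ be one of the logics $IvFDE_{T4}$, $IvFDE_{T45}$, $IvFDE_{TB}$, $IvFDE_{T4B}$, $IvFDE_{T5}$, and let $\Gamma\cup\{\varphi\}$ be a set of formulas over $\Sigma=\{\land,\lor,\to,\neg,\sim,\square\}$. If $\Gamma\models_L\varphi$, then $\Gamma\vdash_L\varphi$.
   Context: Formulas are built from a countable set of propositional variables using binary $\land,\lor,\to$ and unary $\neg,\sim,\square$. Write $\alpha\leftrightarrow\beta$ for $(\alpha\to\beta)\land(\beta\to\alpha)$. Base calculus $IvFDE_T$: the only rule is modus ponens, and the axiom schemas are: - $\varphi\to(\psi\to\varphi)$; - $(\varphi\to(\psi\to\gamma))\to((\varphi\to\psi)\to(\varphi\to\gamma))$; - $\varphi\to(\psi\to(\varphi\land\psi))$; - $(\varphi\land\psi)\to\varphi$; - $(\varphi\land\psi)\to\psi$; - $\varphi\to(\varphi\lor\psi)$; - $\psi\to(\varphi\lor\psi)$; - $(\varphi\to\gamma)\to((\psi\to\gamma)\to((\varphi\lor\psi)\to\gamma))$; - $\neg\neg\varphi\leftrightarrow\varphi$; - $\neg(\varphi\lor\psi)\leftrightarrow(\neg\varphi\land\neg\psi)$; - $\neg(\varphi\land\psi)\leftrightarrow(\neg\varphi\lor\neg\psi)$; - $\neg(\varphi\to\psi)\leftrightarrow(\varphi\land\neg\psi)$; - $\varphi\lor(\varphi\to\psi)$; - $(\sim\psi\to\sim\varphi)\to((\sim\psi\to\varphi)\to\psi)$; - $\square(\varphi\to\psi)\to(\square\varphi\to\square\psi)$; -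 $\square(\varphi\to\psi)\to(\square\sim\psi\to\square\sim\varphi)$; - $\square\sim(\varphi\to\psi)\leftrightarrow(\square\varphi\land\square\sim\psi)$; - $(\square\sim\varphi\lor\square\psi)\to\square(\varphi\to\psi)$; - $\square\varphi\to\varphi$; - $\square\varphi\leftrightarrow\square\sim\sim\varphi$; - $\square(\varphi\land\psi)\leftrightarrow(\square\varphi\land\square\psi)$; - $\square\sim(\varphi\lor\psi)\leftrightarrow\square(\sim\varphi\land\sim\psi)$; - $(\square\sim\varphi\lor\square\sim\psi)\to\square\sim(\varphi\land\psi)$; - $(\square\varphi\lor\square\psi)\to\square(\varphi\lor\psi)$; - $\square\varphi\leftrightarrow\square\sim\neg\varphi$; - $\square\sim\varphi\leftrightarrow\square\sim\neg\neg\varphi$; - $\square\sim(\varphi\land\psi)\to(\square\varphi\to\square\sim\psi)$; - $\square\sim(\varphi\land\psi)\to(\square\psi\to\square\sim\varphi)$; - $\square(\varphi\lor\psi)\to(\square\sim\varphi\to\square\psi)$; - $\square(\varphi\lor\psi)\to(\square\sim\psi\to\square\varphi)$. Additional modal axiom schemas: - (4) $\square\varphi\to\square\square\varphi$; - (5) $\sim\square\sim\square\varphi\to\square\varphi$; - (B) $\sim\square\sim\square\varphi\to\varphi$. The calculi are: $IvFDE_{T4}$ = $IvFDE_T$ + (4); $IvFDE_{T45}$ = $IvFDE_T$ + (4) + (5); $IvFDE_{TB}$ = $IvFDE_T$ + (B); $IvFDE_{T4B}$ = $IvFDE_T$ + (B) + (4); $IvFDE_{T5}$ = $IvFDE_T$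 + (5). Semantics. On $\{0,1\}$ let $\sqcap,\sqcup,\Rightarrow,\sim$ be the Boolean operations. Let $B_T=\{z\in\{0,1\}^4:z_2\le z_1,\ z_1\sqcap z_3=0,\ z_2\sqcap z_4=0,\ z_3\le z_4\}$ and $D=\{z:z_1=1\}$. The multioperations common to all five logics are: - $z\tilde\land w=\{u\in B_T:u_1=z_1\sqcap w_1,\ u_2=z_2\sqcap w_2,\ u_4=z_4\sqcup w_4,\ z_3\sqcup w_3\le u_3\le(z_2\Rightarrow w_3)\sqcap(w_2\Rightarrow z_3)\}$; - $z\tilde\lor w=\{u:u_1=z_1\sqcup w_1,\ u_3=z_3\sqcap w_3,\ u_4=z_4\sqcap w_4,\ z_2\sqcup w_2\le u_2\le(z_3\Rightarrow w_2)\sqcap(w_3\Rightarrow z_2)\}$; - $z\tilde\to w=\{u:u_1=z_1\Rightarrow w_1,\ u_3=z_2\sqcap w_3,\ u_4=z_1\sqcap w_4,\ z_3\sqcup w_2\le u_2\le(z_2\Rightarrow w_2)\sqcap(w_3\Rightarrow z_3)\}$; - $\tilde\sim z=\{u:u_1=\sim z_1,\ u_2=z_3,\ u_3=z_2,\ z_2\le u_4\le\sim z_3\}$; - $\tilde\neg z=\{(z_4,z_3,z_2,z_1)\}$. The interpretation of $\square$ depends on $L$ (each is a set of $u\in B_T$): - $IvFDE_{T4}$: $u_1=u_2=z_2$; - $IvFDE_{T45}$: $u_1=u_2=z_2$ and $u_3=\sim z_2$; - $IvFDE_{TB}$: $u_1=z_2$ and $u_3\ge\sim z_1$; - $IvFDE_{T4B}$: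 $u_1=u_2=z_2$ and $u_3\ge\sim z_1$; - $IvFDE_{T5}$: $u_1=z_2$ and $u_3=\sim z_2$. This gives the Nmatrix $\mathcal M_L$. A valuation is a map $v$ to $B_T$ respecting all multioperations. $\Gamma\models_L\varphi$ iff every valuation over $\mathcal M_L$ designating all of $\Gamma$ designates $\varphi$. *)

theory Defs
  imports Main "HOL-Library.Countable"
begin

datatype 'p fm =
    Var 'p
  | And "'p fm" "'p fm"  (infixr \<open>\<^bold>\<and>\<close> 65)
  | Or "'p fm" "'p fm"   (infixr \<open>\<^bold>\<or>\<close> 60)
  | Imp "'p fm" "'p fm"  (infixr \<open>\<^bold>\<rightarrow>\<close> 55)
  | Neg "'p fm"          (\<open>\<^bold>\<not>_\<close> [80] 80)
  | Sim "'p fm"          (\<open>\<^bold>\<sim>_\<close> [80] 80)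
  | Box "'p fm"          (\<open>\<^bold>\<box>_\<close> [80] 80)

abbreviation Iff :: "'p fm \<Rightarrow> 'p fm \<Rightarrow> 'p fm"  (infix \<open>\<^bold>\<leftrightarrow>\<close> 52) where
  "\<alpha> \<^bold>\<leftrightarrow> \<beta> \<equiv> (\<alpha> \<^bold>\<rightarrow> \<beta>) \<^bold>\<and> (\<beta> \<^bold>\<rightarrow> \<alpha>)"

inductive IvFDE_T_axiom :: "'p fm \<Rightarrow> bool" where
  K: "IvFDE_T_axiom (\<phi> \<^bold>\<rightarrow> (\<psi> \<^bold>\<rightarrow> \<phi>))"
| S: "IvFDE_T_axiom ((\<phi> \<^bold>\<rightarrow> (\<psi> \<^bold>\<rightarrow> \<gamma>)) \<^bold>\<rightarrow> ((\<phi> \<^bold>\<rightarrow> \<psi>) \<^bold>\<rightarrow> (\<phi> \<^bold>\<rightarrow> \<gamma>)))"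
| andI: "IvFDE_T_axiom (\<phi> \<^bold>\<rightarrow> (\<psi> \<^bold>\<rightarrow> (\<phi> \<^bold>\<and> \<psi>)))"
| andE1: "IvFDE_T_axiom ((\<phi> \<^bold>\<and> \<psi>) \<^bold>\<rightarrow> \<phi>)"
| andE2: "IvFDE_T_axiom ((\<phi> \<^bold>\<and> \<psi>) \<^bold>\<rightarrow> \<psi>)"
| orI1: "IvFDE_T_axiom (\<phi> \<^bold>\<rightarrow> (\<phi> \<^bold>\<or> \<psi>))"
| orI2: "IvFDE_T_axiom (\<psi> \<^bold>\<rightarrow> (\<phi> \<^bold>\<or> \<psi>))"
| orE: "IvFDE_T_axiom ((\<phi> \<^bold>\<rightarrow> \<gamma>) \<^bold>\<rightarrow> ((\<psi> \<^bold>\<rightarrow> \<gamma>) \<^bold>\<rightarrow> ((\<phi> \<^bold>\<or> \<psi>) \<^bold>\<rightarrow> \<gamma>)))"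
| neg_neg: "IvFDE_T_axiom (\<^bold>\<not>\<^bold>\<not>\<phi> \<^bold>\<leftrightarrow> \<phi>)"
| neg_or: "IvFDE_T_axiom (\<^bold>\<not>(\<phi> \<^bold>\<or> \<psi>) \<^bold>\<leftrightarrow> (\<^bold>\<not>\<phi> \<^bold>\<and> \<^bold>\<not>\<psi>))"
| neg_and: "IvFDE_T_axiom (\<^bold>\<not>(\<phi> \<^bold>\<and> \<psi>) \<^bold>\<leftrightarrow> (\<^bold>\<not>\<phi> \<^bold>\<or> \<^bold>\<not>\<psi>))"
| neg_imp: "IvFDE_T_axiom (\<^bold>\<not>(\<phi> \<^bold>\<rightarrow> \<psi>) \<^bold>\<leftrightarrow> (\<phi> \<^bold>\<and> \<^bold>\<not>\<psi>))"
| or_imp: "IvFDE_T_axiom (\<phi> \<^bold>\<or> (\<phi> \<^bold>\<rightarrow> \<psi>))"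
| sim_contra: "IvFDE_T_axiom ((\<^bold>\<sim>\<psi> \<^bold>\<rightarrow> \<^bold>\<sim>\<phi>) \<^bold>\<rightarrow> ((\<^bold>\<sim>\<psi> \<^bold>\<rightarrow> \<phi>) \<^bold>\<rightarrow> \<psi>))"
| box_imp: "IvFDE_T_axiom (\<^bold>\<box>(\<phi> \<^bold>\<rightarrow> \<psi>) \<^bold>\<rightarrow> (\<^bold>\<box>\<phi> \<^bold>\<rightarrow> \<^bold>\<box>\<psi>))"
| box_imp_sim: "IvFDE_T_axiom (\<^bold>\<box>(\<phi> \<^bold>\<rightarrow> \<psi>) \<^bold>\<rightarrow> (\<^bold>\<box>\<^bold>\<sim>\<psi> \<^bold>\<rightarrow> \<^bold>\<box>\<^bold>\<sim>\<phi>))"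
| box_sim_imp: "IvFDE_T_axiom (\<^bold>\<box>\<^bold>\<sim>(\<phi> \<^bold>\<rightarrow> \<psi>) \<^bold>\<leftrightarrow> (\<^bold>\<box>\<phi> \<^bold>\<and> \<^bold>\<box>\<^bold>\<sim>\<psi>))"
| imp_box: "IvFDE_T_axiom ((\<^bold>\<box>\<^bold>\<sim>\<phi> \<^bold>\<or> \<^bold>\<box>\<psi>) \<^bold>\<rightarrow> \<^bold>\<box>(\<phi> \<^bold>\<rightarrow> \<psi>))"
| box_T: "IvFDE_T_axiom (\<^bold>\<box>\<phi> \<^bold>\<rightarrow> \<phi>)"
| box_sim_sim: "IvFDE_T_axiom (\<^bold>\<box>\<phi> \<^bold>\<leftrightarrow> \<^bold>\<box>\<^bold>\<sim>\<^bold>\<sim>\<phi>)"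
| box_and: "IvFDE_T_axiom (\<^bold>\<box>(\<phi> \<^bold>\<and> \<psi>) \<^bold>\<leftrightarrow> (\<^bold>\<box>\<phi> \<^bold>\<and> \<^bold>\<box>\<psi>))"
| box_sim_or: "IvFDE_T_axiom (\<^bold>\<box>\<^bold>\<sim>(\<phi> \<^bold>\<or> \<psi>) \<^bold>\<leftrightarrow> \<^bold>\<box>(\<^bold>\<sim>\<phi> \<^bold>\<and> \<^bold>\<sim>\<psi>))"
| sim_and_box: "IvFDE_T_axiom ((\<^bold>\<box>\<^bold>\<sim>\<phi> \<^bold>\<or> \<^bold>\<box>\<^bold>\<sim>\<psi>) \<^bold>\<rightarrow> \<^bold>\<box>\<^bold>\<sim>(\<phi> \<^bold>\<and> \<psi>))"
| or_box: "IvFDE_T_axiom ((\<^bold>\<box>\<phi> \<^bold>\<or> \<^bold>\<box>\<psi>) \<^bold>\<rightarrow> \<^bold>\<box>(\<phi> \<^bold>\<or> \<psi>))"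
| box_sim_neg: "IvFDE_T_axiom (\<^bold>\<box>\<phi> \<^bold>\<leftrightarrow> \<^bold>\<box>\<^bold>\<sim>\<^bold>\<not>\<phi>)"
| box_sim_neg_neg: "IvFDE_T_axiom (\<^bold>\<box>\<^bold>\<sim>\<phi> \<^bold>\<leftrightarrow> \<^bold>\<box>\<^bold>\<sim>\<^bold>\<not>\<^bold>\<not>\<phi>)"
| box_sim_and1: "IvFDE_T_axiom (\<^bold>\<box>\<^bold>\<sim>(\<phi> \<^bold>\<and> \<psi>) \<^bold>\<rightarrow> (\<^bold>\<box>\<phi> \<^bold>\<rightarrow> \<^bold>\<box>\<^bold>\<sim>\<psi>))"
| box_sim_and2: "IvFDE_T_axiom (\<^bold>\<box>\<^bold>\<sim>(\<phi> \<^bold>\<and> \<psi>) \<^bold>\<rightarrow> (\<^bold>\<box>\<psi> \<^bold>\<rightarrow> \<^bold>\<box>\<^bold>\<sim>\<phi>))"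
| box_or1: "IvFDE_T_axiom (\<^bold>\<box>(\<phi> \<^bold>\<or> \<psi>) \<^bold>\<rightarrow> (\<^bold>\<box>\<^bold>\<sim>\<phi> \<^bold>\<rightarrow> \<^bold>\<box>\<psi>))"
| box_or2: "IvFDE_T_axiom (\<^bold>\<box>(\<phi> \<^bold>\<or> \<psi>) \<^bold>\<rightarrow> (\<^bold>\<box>\<^bold>\<sim>\<psi> \<^bold>\<rightarrow> \<^bold>\<box>\<phi>))"

definition axioms_4 :: "'p fm set" where
  "axioms_4 = {\<^bold>\<box>\<phi> \<^bold>\<rightarrow> \<^bold>\<box>\<^bold>\<box>\<phi> | \<phi>. True}"

definition axioms_5 :: "'p fm set" where
  "axioms_5 = {\<^bold>\<sim>\<^bold>\<box>\<^bold>\<sim>\<^bold>\<box>\<phi> \<^bold>\<rightarrow> \<^bold>\<box>\<phi> | \<phi>. True}"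

definition axioms_B :: "'p fm set" where
  "axioms_B = {\<^bold>\<sim>\<^bold>\<box>\<^bold>\<sim>\<^bold>\<box>\<phi> \<^bold>\<rightarrow> \<phi> | \<phi>. True}"

datatype logic = IvFDE_T4 | IvFDE_T45 | IvFDE_TB | IvFDE_T4B | IvFDE_T5

fun modal_axioms :: "logic \<Rightarrow> 'p fm set" where
  "modal_axioms IvFDE_T4 = axioms_4"
| "modal_axioms IvFDE_T45 = axioms_4 \<union> axioms_5"
| "modal_axioms IvFDE_TB = axioms_B"
| "modal_axioms IvFDE_T4B = axioms_B \<union> axioms_4"
| "modal_axioms IvFDE_T5 = axioms_5"

definition axioms_of :: "logic \<Rightarrow> 'p fm set" where
  "axioms_of L = {\<phi>. IvFDE_T_axiom \<phi>} \<union> modal_axioms L"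

inductive derives :: "logic \<Rightarrow> 'p fm set \<Rightarrow> 'p fm \<Rightarrow> bool" for L \<Gamma> where
  prem: "\<phi> \<in> \<Gamma> \<Longrightarrow> derives L \<Gamma> \<phi>"
| ax: "\<phi> \<in> axioms_of L \<Longrightarrow> derives L \<Gamma> \<phi>"
| mp: "derives L \<Gamma> \<phi> \<Longrightarrow> derives L \<Gamma> (\<phi> \<^bold>\<rightarrow> \<psi>) \<Longrightarrow> derives L \<Gamma> \<psi>"

text \<open>The two-element Boolean algebra is \<^typ>\<open>bool\<close>, with its library order
  (\<^term>\<open>False \<le> True\<close>).\<close>

datatype quad = Quad (c1: bool) (c2: bool) (c3: bool) (c4: bool)

definition B_T :: "quad set" where
  "B_T = {z. c2 z \<le> c1 z \<and> \<not> (c1 z \<and> c3 z) \<and> \<not> (c2 z \<and> c4 z) \<and> c3 z \<le> c4 z}"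

definition designated :: "quad set" where
  "designated = {z \<in> B_T. c1 z}"

definition m_and :: "quad \<Rightarrow> quad \<Rightarrow> quad set" where
  "m_and z w = {u \<in> B_T.
     c1 u = (c1 z \<and> c1 w) \<and>
     c2 u = (c2 z \<and> c2 w) \<and>
     c4 u = (c4 z \<or> c4 w) \<and>
     (c3 z \<or> c3 w) \<le> c3 u \<and>
     c3 u \<le> ((c2 z \<longrightarrow> c3 w) \<and> (c2 w \<longrightarrow> c3 z))}"

definition m_or :: "quad \<Rightarrow> quad \<Rightarrow> quad set" where
  "m_or z w = {u \<in> B_T.
     c1 u = (c1 z \<or> c1 w) \<and>
     c3 u = (c3 z \<and> c3 w) \<and>
     c4 u = (c4 z \<and> c4 w) \<and>
     (c2 z \<or> c2 w) \<le> c2 u \<and>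
     c2 u \<le> ((c3 z \<longrightarrow> c2 w) \<and> (c3 w \<longrightarrow> c2 z))}"

definition m_imp :: "quad \<Rightarrow> quad \<Rightarrow> quad set" where
  "m_imp z w = {u \<in> B_T.
     c1 u = (c1 z \<longrightarrow> c1 w) \<and>
     c3 u = (c2 z \<and> c3 w) \<and>
     c4 u = (c1 z \<and> c4 w) \<and>
     (c3 z \<or> c2 w) \<le> c2 u \<and>
     c2 u \<le> ((c2 z \<longrightarrow> c2 w) \<and> (c3 w \<longrightarrow> c3 z))}"

definition m_sim :: "quad \<Rightarrow> quad set" where
  "m_sim z = {u \<in> B_T.
     c1 u = (\<not> c1 z) \<and>
     c2 u = c3 z \<and>
     c3 u = c2 z \<and>
     c2 z \<le> c4 u \<and>
     c4 u \<le> (\<not> c3 z)}"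

definition m_neg :: "quad \<Rightarrow> quad set" where
  "m_neg z = {Quad (c4 z) (c3 z) (c2 z) (c1 z)}"

fun m_box :: "logic \<Rightarrow> quad \<Rightarrow> quad set" where
  "m_box IvFDE_T4 z = {u \<in> B_T. c1 u = c2 z \<and> c2 u = c2 z}"
| "m_box IvFDE_T45 z = {u \<in> B_T. c1 u = c2 z \<and> c2 u = c2 z \<and> c3 u = (\<not> c2 z)}"
| "m_box IvFDE_TB z = {u \<in> B_T. c1 u = c2 z \<and> (\<not> c1 z) \<le> c3 u}"
| "m_box IvFDE_T4B z = {u \<in> B_T. c1 u = c2 z \<and> c2 u = c2 z \<and> (\<not> c1 z) \<le> c3 u}"
| "m_box IvFDE_T5 z = {u \<in> B_T. c1 u = c2 z \<and> c3 u = (\<not> c2 z)}"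

definition valuation :: "logic \<Rightarrow> ('p fm \<Rightarrow> quad) \<Rightarrow> bool" where
  "valuation L v \<longleftrightarrow>
     (\<forall>\<alpha>. v \<alpha> \<in> B_T) \<and>
     (\<forall>\<alpha> \<beta>. v (\<alpha> \<^bold>\<and> \<beta>) \<in> m_and (v \<alpha>) (v \<beta>)) \<and>
     (\<forall>\<alpha> \<beta>. v (\<alpha> \<^bold>\<or> \<beta>) \<in> m_or (v \<alpha>) (v \<beta>)) \<and>
     (\<forall>\<alpha> \<beta>. v (\<alpha> \<^bold>\<rightarrow> \<beta>) \<in> m_imp (v \<alpha>) (v \<beta>)) \<and>
     (\<forall>\<alpha>. v (\<^bold>\<not>\<alpha>) \<in> m_neg (v \<alpha>)) \<and>
     (\<forall>\<alpha>. v (\<^bold>\<sim>\<alpha>) \<in> m_sim (v \<alpha>)) \<and>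
     (\<forall>\<alpha>. v (\<^bold>\<box>\<alpha>) \<in> m_box L (v \<alpha>))"

definition entails :: "logic \<Rightarrow> 'p fm set \<Rightarrow> 'p fm \<Rightarrow> bool" where
  "entails L \<Gamma> \<phi> \<longleftrightarrow>
     (\<forall>v. valuation L v \<longrightarrow> (\<forall>\<gamma>\<in>\<Gamma>. v \<gamma> \<in> designated) \<longrightarrow> v \<phi> \<in> designated)"

end

(* Lindenbaum's lemma extends a set that does not derive the formula phi to a set D that is
   maximal with this property. Membership in D is Boolean for the connectives and, or, imp and
   sim, so alpha |-> (alpha : D, Box alpha : D, Box Sim alpha : D, Neg alpha : D) is a
   valuation, since the axioms, read as conditions on D, are exactly the constraints defining
   B_T and the multioperations; it refutes phi. *)
theory Submission imports Defs begin

lemma derives_mono: "derives L \<Gamma> \<phi> \<Longrightarrow> \<Gamma> \<subseteq> \<Delta> \<Longrightarrow> derives L \<Delta> \<phi>"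
  by (induction rule: derives.induct) (auto intro: derives.intros)

lemma derives_axiom: "IvFDE_T_axiom \<phi> \<Longrightarrow> derives L \<Gamma> \<phi>"
  by (simp add: axioms_of_def derives.ax)

lemma derives_weaken: "derives L \<Gamma> \<psi> \<Longrightarrow> derives L \<Gamma> (\<phi> \<^bold>\<rightarrow> \<psi>)"
  by (meson derives.mp derives_axiom K)

lemma derives_mp_under_imp:
  assumes "derives L \<Gamma> (\<phi> \<^bold>\<rightarrow> \<psi>)" "derives L \<Gamma> (\<phi> \<^bold>\<rightarrow> (\<psi> \<^bold>\<rightarrow> \<gamma>))"
  shows "derives L \<Gamma> (\<phi> \<^bold>\<rightarrow> \<gamma>)"
  by (meson assms derives.mp derives_axiom S)

text \<open>The usual S-K-K proof: both premises are instances of \<open>K\<close>.\<close>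

lemma derives_imp_refl: "derives L \<Gamma> (\<phi> \<^bold>\<rightarrow> \<phi>)"
  by (rule derives_mp_under_imp[where \<psi> = "\<phi> \<^bold>\<rightarrow> \<phi>"]) (rule derives_axiom K)+

text \<open>Modus ponens is the only rule, so \<open>K\<close> handles premises and axioms and
  \<open>S\<close> handles the inductive step.\<close>

lemma deduction:
  assumes "derives L (insert \<phi> \<Gamma>) \<psi>"
  shows "derives L \<Gamma> (\<phi> \<^bold>\<rightarrow> \<psi>)"
  using assms
proof (induction rule: derives.induct)
  case (prem \<psi>)
  then show ?case
    by (auto intro: derives_imp_refl derives_weaken derives.prem)
next
  case (ax \<psi>)
  then show ?case
    by (intro derives_weaken derives.ax)
next
  case (mp \<psi> \<gamma>)
  show ?case
    by (rule derives_mp_under_imp[OF mp.IH])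
qed

text \<open>Derivations are finite: each application of modus ponens combines just two members of
  the chain, and the larger one serves both premises. Nonemptiness supplies a member from which
  axioms can be derived.\<close>

lemma derives_Union_chain:
  assumes "derives L (\<Union>\<C>) \<phi>" "\<C> \<noteq> {}" "subset.chain \<A> \<C>"
  shows "\<exists>X\<in>\<C>. derives L X \<phi>"
  using assms(1)
proof (induction rule: derives.induct)
  case (mp \<phi> \<psi>)
  then obtain X Y where XY: "X \<in> \<C>" "derives L X \<phi>" "Y \<in> \<C>" "derives L Y (\<phi> \<^bold>\<rightarrow> \<psi>)"
    by blast
  \<comment> \<open>\<open>X\<close> and \<open>Y\<close> are comparable, so their union is one of
    them.\<close>
  then have "X \<union> Y \<in> \<C>"
    using assms(3) by (metis subset_chain_def sup.absorb1 sup.absorb2)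
  with XY show ?case
    by (meson derives.mp derives_mono sup_ge1 sup_ge2)
qed (use assms(2) in \<open>auto intro: derives.intros\<close>)

text \<open>The target \<phi> plays the part of falsum: maximality is relative to not deriving
  \<phi>.\<close>

locale maximal_nonderiving =
  fixes L :: logic and \<Delta> :: "'p fm set" and \<phi> :: "'p fm"
  assumes not_derives: "\<not> derives L \<Delta> \<phi>"
    and maximal: "\<alpha> \<notin> \<Delta> \<Longrightarrow> derives L (insert \<alpha> \<Delta>) \<phi>"

lemma lindenbaum:
  assumes "\<not> derives L \<Gamma> \<phi>"
  obtains \<Delta> where "\<Gamma> \<subseteq> \<Delta>" "maximal_nonderiving L \<Delta> \<phi>"
proof -
  let ?A = "{\<Delta>. \<Gamma> \<subseteq> \<Delta> \<and> \<not> derives L \<Delta> \<phi>}"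
  have "\<Union>\<C> \<in> ?A" if "\<C> \<noteq> {}" "subset.chain ?A \<C>" for \<C>
    using that derives_Union_chain[of L \<C> \<phi>] unfolding subset_chain_def by blast
  moreover have "?A \<noteq> {}"
    using assms by blast
  \<comment> \<open>Zorn's lemma for inclusion; unions of nonempty chains stay in \<open>?A\<close>
    because a derivation of \<phi> from the union would already exist in one member.\<close>
  ultimately have "\<exists>\<Delta>\<in>?A. \<forall>X\<in>?A. \<Delta> \<subseteq> X \<longrightarrow> X = \<Delta>"
    by (intro subset_Zorn_nonempty)
  then obtain \<Delta> where \<Delta>: "\<Delta> \<in> ?A" "\<And>X. X \<in> ?A \<Longrightarrow> \<Delta> \<subseteq> X \<Longrightarrow> X = \<Delta>"
    by meson
  have "derives L (insert \<alpha> \<Delta>) \<phi>" if "\<alpha> \<notin> \<Delta>" for \<alpha>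
    using that \<Delta>(1) \<Delta>(2)[of "insert \<alpha> \<Delta>"] by blast
  with \<Delta>(1) show thesis
    by (intro that[of \<Delta>]) (auto simp: maximal_nonderiving_def)
qed

context maximal_nonderiving
begin

lemma imp_conclusion: "\<alpha> \<notin> \<Delta> \<Longrightarrow> derives L \<Delta> (\<alpha> \<^bold>\<rightarrow> \<phi>)"
  by (simp add: deduction maximal)

text \<open>A derivable non-member \<alpha> would yield \<phi> by modus ponens with
  \<open>imp_conclusion\<close>.\<close>

lemma closed: "derives L \<Delta> \<alpha> \<Longrightarrow> \<alpha> \<in> \<Delta>"
  using imp_conclusion derives.mp not_derives by blast

lemma mem_mp: "\<alpha> \<^bold>\<rightarrow> \<beta> \<in> \<Delta> \<Longrightarrow> \<alpha> \<in> \<Delta> \<Longrightarrow> \<beta> \<in> \<Delta>"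
  by (meson closed derives.mp derives.prem)

lemma mem_axiom: "IvFDE_T_axiom \<alpha> \<Longrightarrow> \<alpha> \<in> \<Delta>"
  by (simp add: closed derives_axiom)

lemma conclusion_not_mem: "\<phi> \<notin> \<Delta>"
  using not_derives derives.prem by blast

lemma mem_and: "\<alpha> \<^bold>\<and> \<beta> \<in> \<Delta> \<longleftrightarrow> \<alpha> \<in> \<Delta> \<and> \<beta> \<in> \<Delta>"
  using mem_axiom[OF andI, of \<alpha> \<beta>] mem_axiom[OF andE1, of \<alpha> \<beta>] mem_axiom[OF andE2, of \<alpha> \<beta>]
  by (blast dest: mem_mp)

text \<open>Primeness: if neither disjunct is in \<Delta>, both imply \<phi>, and \<open>orE\<close>
  would put \<phi> into \<Delta>.\<close>

lemma mem_or: "\<alpha> \<^bold>\<or> \<beta> \<in> \<Delta> \<longleftrightarrow> \<alpha> \<in> \<Delta> \<or> \<beta> \<in> \<Delta>"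
proof
  assume or: "\<alpha> \<^bold>\<or> \<beta> \<in> \<Delta>"
  show "\<alpha> \<in> \<Delta> \<or> \<beta> \<in> \<Delta>"
  proof (rule ccontr)
    assume "\<not> (\<alpha> \<in> \<Delta> \<or> \<beta> \<in> \<Delta>)"
    then have "\<alpha> \<^bold>\<rightarrow> \<phi> \<in> \<Delta>" "\<beta> \<^bold>\<rightarrow> \<phi> \<in> \<Delta>"
      by (simp_all add: closed imp_conclusion)
    with or mem_axiom[OF orE, of \<alpha> \<phi> \<beta>] have "\<phi> \<in> \<Delta>"
      by (meson mem_mp)
    with conclusion_not_mem show False ..
  qed
next
  assume "\<alpha> \<in> \<Delta> \<or> \<beta> \<in> \<Delta>"
  then show "\<alpha> \<^bold>\<or> \<beta> \<in> \<Delta>"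
    using mem_axiom[OF orI1, of \<alpha> \<beta>] mem_axiom[OF orI2, of \<beta> \<alpha>] by (meson mem_mp)
qed

text \<open>The case of a non-member \<alpha> rests on \<open>or_imp\<close> together with
  primeness; the case of a member \<beta> is \<open>K\<close>.\<close>

lemma mem_imp: "\<alpha> \<^bold>\<rightarrow> \<beta> \<in> \<Delta> \<longleftrightarrow> (\<alpha> \<in> \<Delta> \<longrightarrow> \<beta> \<in> \<Delta>)"
  using mem_mp[of \<alpha> \<beta>] mem_mp[of \<beta> "\<alpha> \<^bold>\<rightarrow> \<beta>"] mem_axiom[OF K, of \<beta> \<alpha>]
    mem_axiom[OF or_imp, of \<alpha> \<beta>] mem_or[of \<alpha> "\<alpha> \<^bold>\<rightarrow> \<beta>"] by blast

text \<open>The first instance of \<open>sim_contra\<close> gives excluded middle. The second gives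
  explosion: \<alpha> and \<open>Sim\<close> \<alpha> together would force \<phi> into
  \<Delta>.\<close>

lemma mem_sim: "\<^bold>\<sim>\<alpha> \<in> \<Delta> \<longleftrightarrow> \<alpha> \<notin> \<Delta>"
  using mem_axiom[OF sim_contra[of \<alpha> \<alpha>]] mem_axiom[OF sim_contra[of \<phi> \<alpha>]] conclusion_not_mem
  by (auto simp: mem_imp)

text \<open>Unfolding these in the membership of an axiom turns it into a propositional condition on
  the memberships of its modal and negated parts.\<close>

lemmas mem_boolean = mem_and mem_or mem_imp mem_sim

lemmas mem_box_T = mem_axiom[OF box_T, unfolded mem_boolean]

lemma mem_box_sim_sim: "\<^bold>\<box>\<^bold>\<sim>\<^bold>\<sim>\<alpha> \<in> \<Delta> \<longleftrightarrow> \<^bold>\<box>\<alpha> \<in> \<Delta>"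
  using mem_axiom[OF box_sim_sim, of \<alpha>] unfolding mem_boolean by blast

lemma mem_box_sim_neg: "\<^bold>\<box>\<^bold>\<sim>\<^bold>\<not>\<alpha> \<in> \<Delta> \<longleftrightarrow> \<^bold>\<box>\<alpha> \<in> \<Delta>"
  using mem_axiom[OF box_sim_neg, of \<alpha>] unfolding mem_boolean by blast

text \<open>Both sides are equivalent to membership of
  \<open>Box (Sim (Neg (Neg \<alpha>)))\<close>: one by \<open>box_sim_neg_neg\<close>, the other by
  \<open>box_sim_neg\<close> at \<open>Neg \<alpha>\<close>.\<close>

lemma mem_box_neg: "\<^bold>\<box>\<^bold>\<not>\<alpha> \<in> \<Delta> \<longleftrightarrow> \<^bold>\<box>\<^bold>\<sim>\<alpha> \<in> \<Delta>"
  using mem_axiom[OF box_sim_neg_neg, of \<alpha>] mem_box_sim_neg[of "\<^bold>\<not>\<alpha>"] unfolding mem_boolean by blast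

lemma mem_neg_neg: "\<^bold>\<not>\<^bold>\<not>\<alpha> \<in> \<Delta> \<longleftrightarrow> \<alpha> \<in> \<Delta>"
  using mem_axiom[OF neg_neg, of \<alpha>] unfolding mem_boolean by blast

lemma mem_neg_and: "\<^bold>\<not>(\<alpha> \<^bold>\<and> \<beta>) \<in> \<Delta> \<longleftrightarrow> \<^bold>\<not>\<alpha> \<in> \<Delta> \<or> \<^bold>\<not>\<beta> \<in> \<Delta>"
  using mem_axiom[OF neg_and, of \<alpha> \<beta>] unfolding mem_boolean by blast

lemma mem_neg_or: "\<^bold>\<not>(\<alpha> \<^bold>\<or> \<beta>) \<in> \<Delta> \<longleftrightarrow> \<^bold>\<not>\<alpha> \<in> \<Delta> \<and> \<^bold>\<not>\<beta> \<in> \<Delta>"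
  using mem_axiom[OF neg_or, of \<alpha> \<beta>] unfolding mem_boolean by blast

lemma mem_neg_imp: "\<^bold>\<not>(\<alpha> \<^bold>\<rightarrow> \<beta>) \<in> \<Delta> \<longleftrightarrow> \<alpha> \<in> \<Delta> \<and> \<^bold>\<not>\<beta> \<in> \<Delta>"
  using mem_axiom[OF neg_imp, of \<alpha> \<beta>] unfolding mem_boolean by blast

lemma mem_box_and: "\<^bold>\<box>(\<alpha> \<^bold>\<and> \<beta>) \<in> \<Delta> \<longleftrightarrow> \<^bold>\<box>\<alpha> \<in> \<Delta> \<and> \<^bold>\<box>\<beta> \<in> \<Delta>"
  using mem_axiom[OF box_and, of \<alpha> \<beta>] unfolding mem_boolean by blast

lemma mem_box_sim_or: "\<^bold>\<box>\<^bold>\<sim>(\<alpha> \<^bold>\<or> \<beta>) \<in> \<Delta> \<longleftrightarrow> \<^bold>\<box>\<^bold>\<sim>\<alpha> \<in> \<Delta> \<and> \<^bold>\<box>\<^bold>\<sim>\<beta> \<in> \<Delta>"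
  using mem_axiom[OF box_sim_or, of \<alpha> \<beta>] unfolding mem_boolean mem_box_and by blast

lemma mem_box_sim_imp: "\<^bold>\<box>\<^bold>\<sim>(\<alpha> \<^bold>\<rightarrow> \<beta>) \<in> \<Delta> \<longleftrightarrow> \<^bold>\<box>\<alpha> \<in> \<Delta> \<and> \<^bold>\<box>\<^bold>\<sim>\<beta> \<in> \<Delta>"
  using mem_axiom[OF box_sim_imp, of \<alpha> \<beta>] unfolding mem_boolean by blast

definition canonical :: "'p fm \<Rightarrow> quad" where
  "canonical \<alpha> = Quad (\<alpha> \<in> \<Delta>) (\<^bold>\<box>\<alpha> \<in> \<Delta>) (\<^bold>\<box>\<^bold>\<sim>\<alpha> \<in> \<Delta>) (\<^bold>\<not>\<alpha> \<in> \<Delta>)"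

lemma canonical_components [simp]:
  "c1 (canonical \<alpha>) \<longleftrightarrow> \<alpha> \<in> \<Delta>" "c2 (canonical \<alpha>) \<longleftrightarrow> \<^bold>\<box>\<alpha> \<in> \<Delta>"
  "c3 (canonical \<alpha>) \<longleftrightarrow> \<^bold>\<box>\<^bold>\<sim>\<alpha> \<in> \<Delta>" "c4 (canonical \<alpha>) \<longleftrightarrow> \<^bold>\<not>\<alpha> \<in> \<Delta>"
  by (simp_all add: canonical_def)

text \<open>Each of the four constraints is one instance of T, at \<alpha>,
  \<open>Sim \<alpha>\<close>, \<open>Neg \<alpha>\<close> and \<open>Sim (Neg \<alpha>)\<close>;
  the last two are rewritten by the equivalences for boxed negations.\<close>

lemma canonical_in_B_T: "canonical \<alpha> \<in> B_T"
  using mem_box_T[of \<alpha>] mem_box_T[of "\<^bold>\<sim>\<alpha>"] mem_box_T[of "\<^bold>\<not>\<alpha>"] mem_box_T[of "\<^bold>\<sim>\<^bold>\<not>\<alpha>"]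
  by (auto simp: B_T_def mem_box_sim_neg mem_box_neg mem_sim)

text \<open>Equivalences fix every component but the third, for which \<open>sim_and_box\<close>
  gives the lower bound and \<open>box_sim_and1\<close>, \<open>box_sim_and2\<close> the upper
  one.\<close>

lemma canonical_and: "canonical (\<alpha> \<^bold>\<and> \<beta>) \<in> m_and (canonical \<alpha>) (canonical \<beta>)"
  by (simp add: m_and_def canonical_in_B_T mem_boolean mem_neg_and mem_box_and le_bool_def)
    (use mem_axiom[OF sim_and_box, of \<alpha> \<beta>] mem_axiom[OF box_sim_and1, of \<alpha> \<beta>]
      mem_axiom[OF box_sim_and2, of \<alpha> \<beta>] in \<open>unfold mem_boolean, blast\<close>)

text \<open>Here the second component is the open one: \<open>or_box\<close> bounds it below,
  \<open>box_or1\<close> and \<open>box_or2\<close> above.\<close>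

lemma canonical_or: "canonical (\<alpha> \<^bold>\<or> \<beta>) \<in> m_or (canonical \<alpha>) (canonical \<beta>)"
  by (simp add: m_or_def canonical_in_B_T mem_boolean mem_neg_or mem_box_sim_or le_bool_def)
    (use mem_axiom[OF or_box, of \<alpha> \<beta>] mem_axiom[OF box_or1, of \<alpha> \<beta>]
      mem_axiom[OF box_or2, of \<alpha> \<beta>] in \<open>unfold mem_boolean, blast\<close>)

text \<open>Again only the second component is open: \<open>imp_box\<close> bounds it below,
  \<open>box_imp\<close> and \<open>box_imp_sim\<close> above.\<close>

lemma canonical_imp: "canonical (\<alpha> \<^bold>\<rightarrow> \<beta>) \<in> m_imp (canonical \<alpha>) (canonical \<beta>)"
  by (simp add: m_imp_def canonical_in_B_T mem_boolean mem_neg_imp mem_box_sim_imp le_bool_def)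
    (use mem_axiom[OF imp_box, of \<alpha> \<beta>] mem_axiom[OF box_imp, of \<alpha> \<beta>]
      mem_axiom[OF box_imp_sim, of \<alpha> \<beta>] in \<open>unfold mem_boolean, blast\<close>)

lemma canonical_neg: "canonical (\<^bold>\<not>\<alpha>) \<in> m_neg (canonical \<alpha>)"
  by (simp add: m_neg_def canonical_def[of "\<^bold>\<not>\<alpha>"] mem_neg_neg mem_box_neg mem_box_sim_neg)

text \<open>No axiom describes \<open>Neg (Sim \<alpha>)\<close> directly; both bounds on the fourth
  component come from the value of \<open>Sim \<alpha>\<close> lying in \<open>B_T\<close>.\<close>

lemma canonical_sim: "canonical (\<^bold>\<sim>\<alpha>) \<in> m_sim (canonical \<alpha>)"
  using canonical_in_B_T[of "\<^bold>\<sim>\<alpha>"]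
  by (auto simp: m_sim_def B_T_def mem_sim mem_box_sim_sim)

lemma canonical_box: "canonical (\<^bold>\<box>\<alpha>) \<in> m_box L (canonical \<alpha>)"
proof -
  have modal: "\<beta> \<in> modal_axioms L \<Longrightarrow> \<beta> \<in> \<Delta>" for \<beta>
    by (simp add: axioms_of_def closed derives.ax)
  \<comment> \<open>The modal facts are conditional on the schema instance belonging to the logic,
    so that the final case split on \<open>L\<close> uses those available. Here T provides the
    direction converse to (4).\<close>
  have four: "\<^bold>\<box>\<^bold>\<box>\<alpha> \<in> \<Delta> \<longleftrightarrow> \<^bold>\<box>\<alpha> \<in> \<Delta>" if "\<^bold>\<box>\<alpha> \<^bold>\<rightarrow> \<^bold>\<box>\<^bold>\<box>\<alpha> \<in> modal_axioms L"
    using modal[OF that] mem_box_T[of "\<^bold>\<box>\<alpha>"] by (auto simp: mem_imp)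
  \<comment> \<open>Contraposing (5) gives one direction; T at \<open>Sim (Box \<alpha>)\<close>
    gives the other.\<close>
  have five: "\<^bold>\<box>\<^bold>\<sim>\<^bold>\<box>\<alpha> \<in> \<Delta> \<longleftrightarrow> \<^bold>\<box>\<alpha> \<notin> \<Delta>" if "\<^bold>\<sim>\<^bold>\<box>\<^bold>\<sim>\<^bold>\<box>\<alpha> \<^bold>\<rightarrow> \<^bold>\<box>\<alpha> \<in> modal_axioms L"
    using modal[OF that] mem_box_T[of "\<^bold>\<sim>\<^bold>\<box>\<alpha>"] by (auto simp: mem_imp mem_sim)
  \<comment> \<open>The contrapositive of (B) is exactly the lower bound on the third
    component.\<close>
  have B: "\<alpha> \<notin> \<Delta> \<longrightarrow> \<^bold>\<box>\<^bold>\<sim>\<^bold>\<box>\<alpha> \<in> \<Delta>" if "\<^bold>\<sim>\<^bold>\<box>\<^bold>\<sim>\<^bold>\<box>\<alpha> \<^bold>\<rightarrow> \<alpha> \<in> modal_axioms L"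
    using modal[OF that] by (auto simp: mem_imp mem_sim)
  show ?thesis
    using four five B
    by (cases L) (auto simp: canonical_in_B_T axioms_4_def axioms_5_def axioms_B_def)
qed

lemma canonical_valuation: "valuation L canonical"
  by (simp add: valuation_def canonical_in_B_T canonical_and canonical_or canonical_imp
      canonical_neg canonical_sim canonical_box)

lemma canonical_designated: "canonical \<alpha> \<in> designated \<longleftrightarrow> \<alpha> \<in> \<Delta>"
  using canonical_in_B_T by (simp add: designated_def canonical_def)

end

theorem mainTheorem11:
  fixes L :: logic and \<Gamma> :: "('p::countable) fm set" and \<phi> :: "'p fm"
  assumes "entails L \<Gamma> \<phi>"
  shows "derives L \<Gamma> \<phi>"
proof (rule ccontr)
  assume "\<not> derives L \<Gamma> \<phi>"
  then obtain \<Delta> where "\<Gamma> \<subseteq> \<Delta>" and "maximal_nonderiving L \<Delta> \<phi>"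
    by (rule lindenbaum)
  then interpret maximal_nonderiving L \<Delta> \<phi>
    by simp
  \<comment> \<open>The canonical valuation designates all of \<Gamma>, since \<Gamma> lies inside
    \<Delta>.\<close>
  have "canonical \<phi> \<in> designated"
    using assms canonical_valuation \<open>\<Gamma> \<subseteq> \<Delta>\<close> canonical_designated
    unfolding entails_def by blast
  then show False
    using canonical_designated conclusion_not_mem by blast
qed

end
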